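(* Let $\xi$ and $\eta$ be biorthogonal random vectors in $\mathbb R^N$. Then for every integer $0\le n<N$, $$d_n^{\mathrm{avg}}(\xi,\ell_q^N)_q\ \ge\ \frac{(N-n)^{1/q}}{\sigma_{q'}(\eta)}\quad\text{if } 1<q\le 2,$$ $$d_n^{\mathrm{avg}}(\xi,\ell_q^N)_q\ \ge\ \frac{(N-n)^{1/2}N^{1/q-1/2}}{\sigma_{q'}(\eta)}\quad\text{if } 2\le q<\infty,$$ where $1/q+1/q'=1$.
   Context: $\ell_q^N$ is $\mathbb R^N$ with the norm $\|x\|_q=(\sum_{k=1}^N|x_k|^q)^{1/q}$; $|x|$ denotes the Euclidean norm. For a (Borel) random vector $\xi$ in a normed space $X$ and $1\le p<\infty$, the $p$-averaged Kolmogorov width is $d_n^{\mathrm{avg}}(\xi,X)_p=\inf_{Q_n}\left(\mathsf E\,\rho(\xi,Q_n)_X^p\right)^{1/p}$, where $\rho(x,Q)_X=\inf_{y\in Q}\|x-y\|_X$ and the infimum is over all linear subspaces $Q_n\subset X$ of dimension at most $n$. Random vectors $\xi=(\xi_1,\dots,\xi_N)$ and $\eta=(\eta_1,\dots,\eta_N)$ (defined on the same probability space) are biorthogonal if $\mathsf E\,\xi_i\eta_i=1$ for all $i$ and $\mathsf E\,\xi_i\eta_j=0$ for all $i\ne j$. The weak $p$-moment of a random vector $\eta$ in $\mathbb R^N$ is $\sigma_p(\eta)=\sup_{v\in\mathbb R^N,\,|v|=1}(\mathsf E|\langle\eta,v\rangle|^p)^{1/p}$ (a value in $[0,\infty]$;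 if it is $\infty$ the quotient is read as $0$). *)

theory Defs
  imports "HOL-Probability.Probability"
begin

text \<open>Extended power \<open>x\<^sup>a\<close> on \<open>[0,\<infinity>]\<close>, intended for exponents \<open>a > 0\<close>
  (so that \<open>\<infinity>\<^sup>a = \<infinity>\<close>).\<close>

definition ennreal_powr :: "ennreal \<Rightarrow> real \<Rightarrow> ennreal" where
  "ennreal_powr x a = (if x = \<top> then \<top> else ennreal (enn2real x powr a))"

text \<open>\<open>(E |f|\<^sup>p)\<^bsup>1/p\<^esup>\<close> as a value in \<open>[0,\<infinity>]\<close>; it is \<open>\<infinity>\<close> when the \<open>p\<close>-th moment is infinite.\<close>

definition p_mean :: "'w measure \<Rightarrow> real \<Rightarrow> ('w \<Rightarrow> real) \<Rightarrow> ennreal" where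
  "p_mean M p f = ennreal_powr (\<integral>\<^sup>+ \<omega>. ennreal (\<bar>f \<omega>\<bar> powr p) \<partial>M) (1 / p)"

definition lq_norm :: "real \<Rightarrow> real ^ 'n \<Rightarrow> real" where
  "lq_norm q x = (\<Sum>k\<in>UNIV. \<bar>x $ k\<bar> powr q) powr (1 / q)"

text \<open>The normed space is given by its underlying finite-dimensional vector space together with an
  explicit norm function \<open>nrm\<close>, since the norm of interest is in general not the type class norm.\<close>

definition dist_to :: "('a::euclidean_space \<Rightarrow> real) \<Rightarrow> 'a \<Rightarrow> 'a set \<Rightarrow> real" where
  "dist_to nrm x Q = (INF y\<in>Q. nrm (x - y))"

definition avg_kolmogorov_width ::
  "'w measure \<Rightarrow> ('w \<Rightarrow> 'a::euclidean_space) \<Rightarrow> ('a \<Rightarrow> real) \<Rightarrow> real \<Rightarrow> nat \<Rightarrow> ennreal" where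
  "avg_kolmogorov_width M \<xi> nrm p n =
     (INF Q\<in>{Q. subspace Q \<and> dim Q \<le> n}. p_mean M p (\<lambda>\<omega>. dist_to nrm (\<xi> \<omega>) Q))"

text \<open>Integrability is part of the definition, because the Bochner integral of a
  non-integrable function is \<open>0\<close> by convention.\<close>

definition biorthogonal ::
  "'w measure \<Rightarrow> ('w \<Rightarrow> real ^ 'n) \<Rightarrow> ('w \<Rightarrow> real ^ 'n) \<Rightarrow> bool" where
  "biorthogonal M \<xi> \<eta> \<longleftrightarrow>
     (\<forall>i j. integrable M (\<lambda>\<omega>. \<xi> \<omega> $ i * \<eta> \<omega> $ j)) \<and>
     (\<forall>i. (LINT \<omega>|M. \<xi> \<omega> $ i * \<eta> \<omega> $ i) = 1) \<and>
     (\<forall>i j. i \<noteq> j \<longrightarrow> (LINT \<omega>|M. \<xi> \<omega> $ i * \<eta> \<omega> $ j) = 0)"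

definition weak_moment :: "'w measure \<Rightarrow> real \<Rightarrow> ('w \<Rightarrow> real ^ 'n) \<Rightarrow> ennreal" where
  "weak_moment M p \<eta> = (SUP v\<in>{v. norm v = 1}. p_mean M p (\<lambda>\<omega>. \<eta> \<omega> \<bullet> v))"

end

theory Submission
  imports Defs
begin

text \<open>
  The bound is a trace duality argument. Let \<open>Q\<close> be a subspace of dimension at most \<open>n\<close> and \<open>P\<close>
  the orthogonal projection onto its orthogonal complement, of rank \<open>m \<ge> N - n\<close>. Biorthogonality
  says that \<open>E \<xi>\<^sub>i \<eta>\<^sub>j\<close> is the identity matrix, so that \<open>E \<langle>\<xi>, P \<eta>\<rangle>\<close> is the trace \<open>m\<close> of \<open>P\<close>
  (\<open>expectation_inner_proj_onto\<close>). On the other hand \<open>P \<eta>\<close> annihilates \<open>Q\<close>, so \<open>\<xi>\<close> may be replaced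
  by \<open>\<xi> - y\<close> with \<open>y \<in> Q\<close> depending on the sample point. Hoelder's inequality on the coordinates
  and then on the probability space gives
  \<open>m \<le> E (\<rho>(\<xi>, Q) \<parallel>P \<eta>\<parallel>\<^bsub>q'\<^esub>) \<le> d (E \<parallel>P \<eta>\<parallel>\<^bsub>q'\<^esub>\<^bsup>q'\<^esup>)\<^bsup>1/q'\<^esup>\<close>,
  where \<open>d\<close> is the \<open>q\<close>-mean of the distance.

  The coordinates of \<open>P \<eta>\<close> are \<open>\<langle>\<eta>, P e\<^sub>k\<rangle>\<close>, so the last factor is at most \<open>\<sigma>\<^bsub>q'\<^esub>(\<eta>)\<close> times the
  \<open>q'\<close>-norm of the vector of column lengths \<open>|P e\<^sub>k|\<close>; this is \<open>codimension_le_p_mean_dist_to\<close>.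
  It remains to bound that norm, given that \<open>|P e\<^sub>k| \<le> 1\<close> and that the sum of the \<open>|P e\<^sub>k|\<^sup>2\<close> is \<open>m\<close>.
  If \<open>q' \<ge> 2\<close>, then \<open>|P e\<^sub>k|\<^bsup>q'\<^esup> \<le> |P e\<^sub>k|\<^sup>2\<close> and the norm is at most \<open>m\<^bsup>1/q'\<^esup>\<close>. If \<open>q' < 2\<close>, comparing
  power means gives \<open>m\<^bsup>1/2\<^esup> N\<^bsup>1/q' - 1/2\<^esup>\<close>. Solving for \<open>d\<close> yields the two lower bounds.
\<close>

section \<open>The inequality of Hoelder\<close>

text \<open>Integrating Young's inequality for the factors scaled to norm 1 gives the bound 1 for the
  integral of the scaled product. If a factor has norm 0, it cannot be scaled, but then the product
  vanishes almost everywhere.\<close>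

lemma Holder_inequality_integral:
  fixes f g :: "'a \<Rightarrow> real" and p q :: real
  assumes p: "1 < p" and q: "1 < q" and pq: "1 / p + 1 / q = 1"
    and [measurable]: "f \<in> borel_measurable M" "g \<in> borel_measurable M"
    and f: "integrable M (\<lambda>x. \<bar>f x\<bar> powr p)"
    and g: "integrable M (\<lambda>x. \<bar>g x\<bar> powr q)"
  shows "integrable M (\<lambda>x. \<bar>f x * g x\<bar>)" (is "integrable M ?h")
    and "(\<integral>x. \<bar>f x * g x\<bar> \<partial>M)
           \<le> (\<integral>x. \<bar>f x\<bar> powr p \<partial>M) powr (1 / p) * (\<integral>x. \<bar>g x\<bar> powr q \<partial>M) powr (1 / q)"
proof -
  have young: "\<bar>a * b\<bar> \<le> \<bar>a\<bar> powr p / p + \<bar>b\<bar> powr q / q" for a b :: real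
    using Youngs_inequality[OF p q pq, of "\<bar>a\<bar>" "\<bar>b\<bar>"] by (simp add: abs_mult)
  show int: "integrable M ?h"
    by (rule Bochner_Integration.integrable_bound
          [of M "\<lambda>x. \<bar>f x\<bar> powr p / p + \<bar>g x\<bar> powr q / q"])
      (use f g young p q in \<open>auto intro!: AE_I2 simp: abs_of_nonneg add_nonneg_nonneg\<close>)
  define F where "F = (\<integral>x. \<bar>f x\<bar> powr p \<partial>M)"
  define G where "G = (\<integral>x. \<bar>g x\<bar> powr q \<partial>M)"
  have F0: "0 \<le> F" and G0: "0 \<le> G"
    unfolding F_def G_def by (auto intro: integral_nonneg_AE)
  show "integral\<^sup>L M ?h \<le> F powr (1 / p) * G powr (1 / q)"
  proof (cases "F = 0 \<or> G = 0")
    case True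
    have "AE x in M. ?h x = 0"
    proof (cases "F = 0")
      case True
      then have "AE x in M. \<bar>f x\<bar> powr p = 0"
        using integral_nonneg_eq_0_iff_AE[OF f] by (auto simp: F_def)
      then show ?thesis by eventually_elim auto
    next
      case False
      with \<open>F = 0 \<or> G = 0\<close> have "AE x in M. \<bar>g x\<bar> powr q = 0"
        using integral_nonneg_eq_0_iff_AE[OF g] by (auto simp: G_def)
      then show ?thesis by eventually_elim auto
    qed
    then have "integral\<^sup>L M ?h = 0"
      by (rule integral_eq_zero_AE)
    then show ?thesis by simp
  next
    case False
    with F0 G0 have FG: "0 < F" "0 < G" by auto
    define A where "A = F powr (1 / p)"
    define B where "B = G powr (1 / q)"
    have AB: "0 < A" "0 < B" "A powr p = F" "B powr q = G"
      using FG p q by (auto simp: A_def B_def powr_powr)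
    have "integral\<^sup>L M ?h / (A * B) = (\<integral>x. \<bar>f x / A * (g x / B)\<bar> \<partial>M)"
      using AB by (simp add: abs_mult)
    also have "\<dots> \<le> (\<integral>x. \<bar>f x\<bar> powr p / F / p + \<bar>g x\<bar> powr q / G / q \<partial>M)"
    proof (rule integral_mono)
      have "integrable M (\<lambda>x. ?h x / (A * B))" using int by simp
      then show "integrable M (\<lambda>x. \<bar>f x / A * (g x / B)\<bar>)"
        using AB by (simp add: abs_mult)
      show "integrable M (\<lambda>x. \<bar>f x\<bar> powr p / F / p + \<bar>g x\<bar> powr q / G / q)"
        using f g by simp
      show "\<bar>f x / A * (g x / B)\<bar> \<le> \<bar>f x\<bar> powr p / F / p + \<bar>g x\<bar> powr q / G / q" for x
        using young[of "f x / A" "g x / B"] AB by (simp add: powr_divide)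
    qed
    also have "\<dots> = F / F / p + G / G / q"
      using f g by (simp add: F_def G_def)
    also have "\<dots> = 1"
      using FG pq by simp
    finally show ?thesis
      using AB by (simp add: divide_le_eq A_def B_def)
  qed
qed

lemma Holder_inequality_sum:
  fixes f g :: "'a::finite \<Rightarrow> real" and p q :: real
  assumes "1 < p" "1 < q" "1 / p + 1 / q = 1"
  shows "(\<Sum>x\<in>UNIV. \<bar>f x * g x\<bar>)
           \<le> (\<Sum>x\<in>UNIV. \<bar>f x\<bar> powr p) powr (1 / p) * (\<Sum>x\<in>UNIV. \<bar>g x\<bar> powr q) powr (1 / q)"
  using Holder_inequality_integral(2)[OF assms, of f "count_space UNIV" g]
  by (simp add: lebesgue_integral_count_space_finite integrable_count_space)

section \<open>Moments and distances\<close>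

text \<open>Finite extended means are turned into real integrals, where the real-valued Hoelder inequality
  applies.\<close>

lemma p_mean_finite:
  assumes [measurable]: "f \<in> borel_measurable M" and "p_mean M p f \<noteq> \<top>"
  shows "integrable M (\<lambda>\<omega>. \<bar>f \<omega>\<bar> powr p)"
    and "p_mean M p f = ennreal ((\<integral>\<omega>. \<bar>f \<omega>\<bar> powr p \<partial>M) powr (1 / p))"
proof -
  have fin: "(\<integral>\<^sup>+ \<omega>. ennreal (\<bar>f \<omega>\<bar> powr p) \<partial>M) \<noteq> \<top>"
    using assms(2) by (auto simp: p_mean_def ennreal_powr_def)
  then show int: "integrable M (\<lambda>\<omega>. \<bar>f \<omega>\<bar> powr p)"
    by (intro integrableI_nonneg) (auto simp: top.not_eq_extremum)
  show "p_mean M p f = ennreal ((\<integral>\<omega>. \<bar>f \<omega>\<bar> powr p \<partial>M) powr (1 / p))"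
    using nn_integral_eq_integral[OF int]
    by (simp add: p_mean_def ennreal_powr_def integral_nonneg_AE)
qed

text \<open>The supremum over unit vectors controls all directions, by homogeneity.\<close>

lemma weak_moment_bound:
  fixes \<eta> :: "'w \<Rightarrow> real ^ 'n"
  assumes [measurable]: "\<eta> \<in> borel_measurable M"
    and s: "weak_moment M p \<eta> = ennreal s" "0 \<le> s" and p: "1 < p"
  shows "integrable M (\<lambda>\<omega>. \<bar>\<eta> \<omega> \<bullet> v\<bar> powr p)"
    and "(\<integral>\<omega>. \<bar>\<eta> \<omega> \<bullet> v\<bar> powr p \<partial>M) \<le> (s * norm v) powr p"
proof -
  have unit: "integrable M (\<lambda>\<omega>. \<bar>\<eta> \<omega> \<bullet> u\<bar> powr p) \<and> (\<integral>\<omega>. \<bar>\<eta> \<omega> \<bullet> u\<bar> powr p \<partial>M) \<le> s powr p"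
    if u: "norm u = 1" for u
  proof -
    have le: "p_mean M p (\<lambda>\<omega>. \<eta> \<omega> \<bullet> u) \<le> ennreal s"
      unfolding s(1)[symmetric] weak_moment_def by (rule SUP_upper) (use u in auto)
    then have fin: "p_mean M p (\<lambda>\<omega>. \<eta> \<omega> \<bullet> u) \<noteq> \<top>"
      by (auto simp: top_unique)
    have m: "(\<lambda>\<omega>. \<eta> \<omega> \<bullet> u) \<in> borel_measurable M" by measurable
    define I where "I = (\<integral>\<omega>. \<bar>\<eta> \<omega> \<bullet> u\<bar> powr p \<partial>M)"
    have I0: "0 \<le> I" unfolding I_def by (auto intro: integral_nonneg_AE)
    have "I powr (1 / p) \<le> s"
      using le s(2) unfolding p_mean_finite(2)[OF m fin] I_def by simp
    then have "(I powr (1 / p)) powr p \<le> s powr p"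
      using p by (intro powr_mono2) auto
    then show ?thesis
      using I0 p p_mean_finite(1)[OF m fin] by (simp add: powr_powr I_def)
  qed
  have "integrable M (\<lambda>\<omega>. \<bar>\<eta> \<omega> \<bullet> v\<bar> powr p) \<and> (\<integral>\<omega>. \<bar>\<eta> \<omega> \<bullet> v\<bar> powr p \<partial>M) \<le> (s * norm v) powr p"
  proof (cases "v = 0")
    case False
    define u where "u = v /\<^sub>R norm v"
    have u: "norm u = 1" "v = norm v *\<^sub>R u"
      using False by (auto simp: u_def)
    have eq: "\<bar>\<eta> \<omega> \<bullet> v\<bar> powr p = norm v powr p * \<bar>\<eta> \<omega> \<bullet> u\<bar> powr p" for \<omega>
      by (subst u(2)) (simp add: abs_mult powr_mult)
    show ?thesis
      unfolding eq using unit[OF u(1)] s(2)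
      by (auto simp: powr_mult mult.commute[of _ "norm v powr p"] intro!: mult_left_mono)
  qed auto
  then show "integrable M (\<lambda>\<omega>. \<bar>\<eta> \<omega> \<bullet> v\<bar> powr p)"
    and "(\<integral>\<omega>. \<bar>\<eta> \<omega> \<bullet> v\<bar> powr p \<partial>M) \<le> (s * norm v) powr p" by auto
qed

lemma lq_norm_nonneg: "0 \<le> lq_norm q x"
  by (simp add: lq_norm_def)

lemma lq_norm_powr:
  assumes "0 < q"
  shows "lq_norm q x powr q = (\<Sum>k\<in>UNIV. \<bar>x $ k\<bar> powr q)"
  using assms by (simp add: lq_norm_def powr_powr sum_nonneg)

lemma Holder_inequality_lq_norm:
  assumes "1 < p" "1 < q" "1 / p + 1 / q = 1"
  shows "\<bar>x \<bullet> y\<bar> \<le> lq_norm p x * lq_norm q y"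
proof -
  have "\<bar>x \<bullet> y\<bar> \<le> (\<Sum>k\<in>UNIV. \<bar>x $ k * y $ k\<bar>)"
    unfolding inner_vec_def by (simp add: sum_abs)
  also have "\<dots> \<le> lq_norm p x * lq_norm q y"
    unfolding lq_norm_def by (rule Holder_inequality_sum[OF assms])
  finally show ?thesis .
qed

lemma continuous_on_lq_norm_diff:
  assumes "0 < q"
  shows "continuous_on UNIV (\<lambda>x. lq_norm q (x - y))"
  unfolding lq_norm_def
  using assms by (intro continuous_intros continuous_on_powr') (auto intro: sum_nonneg)

lemma bdd_below_lq_norm: "bdd_below ((\<lambda>y. lq_norm q (x - y)) ` Q)"
  by (rule bdd_belowI2[of _ 0]) (rule lq_norm_nonneg)

text \<open>An infimum of continuous functions is upper semicontinuous: its strict sublevel sets are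
  unions of open sets, however many points \<open>Q\<close> has.\<close>

lemma borel_measurable_dist_to_lq_norm:
  fixes Q :: "(real ^ 'n) set"
  assumes "0 < q" "Q \<noteq> {}"
  shows "(\<lambda>x. dist_to (lq_norm q) x Q) \<in> borel_measurable borel"
proof (rule borel_measurableI_less)
  fix a :: real
  have "{x \<in> space borel. dist_to (lq_norm q) x Q < a} = (\<Union>y\<in>Q. {x. lq_norm q (x - y) < a})"
    using assms(2) by (auto simp: dist_to_def cINF_less_iff[OF _ bdd_below_lq_norm])
  moreover have "open {x. lq_norm q (x - y) < a}" for y :: "real ^ 'n"
    using continuous_on_lq_norm_diff[OF assms(1)] by (rule open_Collect_less) (rule continuous_on_const)
  ultimately show "{x \<in> space borel. dist_to (lq_norm q) x Q < a} \<in> sets borel"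
    by (auto intro!: borel_open)
qed

text \<open>The pairing with a vector orthogonal to \<open>Q\<close> does not see a shift by \<open>y \<in> Q\<close>, so Hoelder's
  inequality holds for every \<open>x - y\<close> and hence for the infimum. Working pointwise with the infimum
  avoids choosing a nearest point measurably.\<close>

lemma inner_le_dist_to_lq_norm:
  fixes Q :: "(real ^ 'n) set"
  assumes pq: "1 < p" "1 < q" "1 / p + 1 / q = 1"
    and Q: "Q \<noteq> {}" and orth: "\<And>y. y \<in> Q \<Longrightarrow> y \<bullet> z = 0"
  shows "\<bar>x \<bullet> z\<bar> \<le> dist_to (lq_norm p) x Q * lq_norm q z"
proof (cases "lq_norm q z = 0")
  case True
  then show ?thesis
    using Holder_inequality_lq_norm[OF pq, of x z] by simp
next
  case False
  then have pos: "0 < lq_norm q z"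
    using lq_norm_nonneg[of q z] by simp
  have "\<bar>x \<bullet> z\<bar> / lq_norm q z \<le> dist_to (lq_norm p) x Q"
    unfolding dist_to_def
  proof (rule cINF_greatest[OF Q])
    fix y assume "y \<in> Q"
    then have "x \<bullet> z = (x - y) \<bullet> z"
      using orth by (simp add: inner_diff_left)
    then show "\<bar>x \<bullet> z\<bar> / lq_norm q z \<le> lq_norm p (x - y)"
      using Holder_inequality_lq_norm[OF pq, of "x - y" z] pos by (simp add: divide_le_eq)
  qed
  then show ?thesis
    using pos by (simp add: divide_le_eq)
qed

section \<open>Orthogonal projections and their column lengths\<close>

definition orthonormal :: "'a::real_inner set \<Rightarrow> bool" where
  "orthonormal B \<longleftrightarrow> finite B \<and> pairwise orthogonal B \<and> (\<forall>b\<in>B. norm b = 1)"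

text \<open>The orthogonal projection onto the span of \<open>B\<close>, when \<open>B\<close> is orthonormal.\<close>

definition proj_onto :: "'a::real_inner set \<Rightarrow> 'a \<Rightarrow> 'a" where
  "proj_onto B x = (\<Sum>b\<in>B. (x \<bullet> b) *\<^sub>R b)"

lemma inner_proj_onto: "x \<bullet> proj_onto B y = (\<Sum>b\<in>B. (x \<bullet> b) * (y \<bullet> b))"
  by (simp add: proj_onto_def inner_sum_right mult.commute)

lemma inner_proj_onto_commute: "x \<bullet> proj_onto B y = y \<bullet> proj_onto B x"
  by (simp add: inner_proj_onto mult.commute)

lemma norm_proj_onto_power2:
  assumes "orthonormal B"
  shows "(norm (proj_onto B x))\<^sup>2 = (\<Sum>b\<in>B. (x \<bullet> b)\<^sup>2)"
proof -
  have "proj_onto B x \<bullet> b = x \<bullet> b" if b: "b \<in> B" for b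
  proof -
    have "proj_onto B x \<bullet> b = (\<Sum>c\<in>B. if c = b then x \<bullet> b else 0)"
      unfolding proj_onto_def inner_sum_left
    proof (rule sum.cong)
      fix c assume "c \<in> B"
      with b assms show "(x \<bullet> c) *\<^sub>R c \<bullet> b = (if c = b then x \<bullet> b else 0)"
        by (auto simp: orthonormal_def pairwise_def orthogonal_def dot_square_norm)
    qed simp
    also have "\<dots> = x \<bullet> b"
      using assms b by (simp add: orthonormal_def)
    finally show ?thesis .
  qed
  then show ?thesis
    unfolding power2_norm_eq_inner inner_proj_onto
    by (simp add: power2_eq_square inner_commute[of x])
qed

text \<open>Bessel's inequality.\<close>

lemma norm_proj_onto_le:
  assumes "orthonormal B"
  shows "norm (proj_onto B x) \<le> norm x"
proof -
  have "(norm (proj_onto B x))\<^sup>2 = x \<bullet> proj_onto B x"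
    unfolding norm_proj_onto_power2[OF assms] inner_proj_onto by (simp add: power2_eq_square)
  also have "\<dots> \<le> norm x * norm (proj_onto B x)"
    by (rule norm_cauchy_schwarz)
  finally show ?thesis
    by (cases "norm (proj_onto B x) = 0") (auto simp: power2_eq_square)
qed

text \<open>The squared Hilbert-Schmidt norm of a projection is its rank: both sides count the squared
  lengths of the basis vectors.\<close>

lemma sum_norm_proj_onto_axis_power2:
  fixes B :: "(real ^ 'n) set"
  assumes "orthonormal B"
  shows "(\<Sum>k\<in>UNIV. (norm (proj_onto B (axis k 1)))\<^sup>2) = real (card B)"
proof -
  have "(\<Sum>k\<in>UNIV. (norm (proj_onto B (axis k 1)))\<^sup>2) = (\<Sum>b\<in>B. \<Sum>k\<in>UNIV. (b $ k)\<^sup>2)"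
    by (subst sum.swap) (simp add: norm_proj_onto_power2[OF assms] inner_axis')
  also have "\<dots> = (\<Sum>b\<in>B. (norm b)\<^sup>2)"
    unfolding power2_norm_eq_inner by (simp add: inner_vec_def power2_eq_square)
  also have "\<dots> = real (card B)"
    using assms by (simp add: orthonormal_def)
  finally show ?thesis .
qed

text \<open>The column lengths are at most 1, so raising the exponent above 2 only decreases their
  powers.\<close>

lemma lq_norm_proj_onto_axes_le_exponent_ge_2:
  fixes B :: "(real ^ 'n) set"
  assumes B: "orthonormal B" and r: "2 \<le> r"
  shows "lq_norm r (\<chi> k. norm (proj_onto B (axis k 1))) \<le> real (card B) powr (1 / r)"
proof -
  have "t powr r \<le> t\<^sup>2" if "0 \<le> t" "t \<le> 1" for t :: real
    using powr_mono'[of 2 r t] that r by (cases "t = 0") (auto simp: powr_numeral)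
  then have "(\<Sum>k\<in>UNIV. norm (proj_onto B (axis k 1)) powr r)
      \<le> (\<Sum>k\<in>UNIV. (norm (proj_onto B (axis k 1 :: real ^ 'n)))\<^sup>2)"
    by (intro sum_mono) (use norm_proj_onto_le[OF B, of "axis _ 1"] in auto)
  then show ?thesis
    using r by (auto simp: lq_norm_def sum_norm_proj_onto_axis_power2[OF B] intro!: powr_mono2 sum_nonneg)
qed

text \<open>Below the exponent 2 the power means of the column lengths are compared, by Hoelder's
  inequality against the constant 1 with the exponent \<open>2 / r\<close> and its conjugate \<open>2 / (2 - r)\<close>.\<close>

lemma lq_norm_proj_onto_axes_le_exponent_less_2:
  fixes B :: "(real ^ 'n) set"
  assumes B: "orthonormal B" and r: "1 < r" "r < 2"
  shows "lq_norm r (\<chi> k. norm (proj_onto B (axis k 1)))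
           \<le> real (card B) powr (1 / 2) * real CARD('n) powr (1 / r - 1 / 2)"
proof -
  define t where "t k = norm (proj_onto B (axis k 1 :: real ^ 'n))" for k
  have sq: "(t k powr r) powr (2 / r) = (t k)\<^sup>2" for k
    using r by (cases "t k = 0") (auto simp: powr_powr t_def powr_numeral)
  have "(\<Sum>k\<in>UNIV. \<bar>t k powr r * 1\<bar>)
      \<le> (\<Sum>k\<in>UNIV. \<bar>t k powr r\<bar> powr (2 / r)) powr (1 / (2 / r))
          * (\<Sum>k\<in>(UNIV::'n set). \<bar>1\<bar> powr (2 / (2 - r))) powr (1 / (2 / (2 - r)))"
    by (rule Holder_inequality_sum) (use r in \<open>auto simp: field_simps\<close>)
  then have "(\<Sum>k\<in>UNIV. t k powr r) \<le> real (card B) powr (r / 2) * real CARD('n) powr ((2 - r) / 2)"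
    by (simp add: sq) (simp add: t_def sum_norm_proj_onto_axis_power2[OF B])
  then have "(\<Sum>k\<in>UNIV. t k powr r) powr (1 / r)
      \<le> (real (card B) powr (r / 2) * real CARD('n) powr ((2 - r) / 2)) powr (1 / r)"
    using r by (intro powr_mono2) (auto intro: sum_nonneg)
  also have "\<dots> = real (card B) powr (1 / 2) * real CARD('n) powr ((2 - r) / 2 / r)"
    using r by (simp add: powr_mult powr_powr)
  also have "(2 - r) / 2 / r = 1 / r - 1 / 2"
    using r by (simp add: field_simps)
  finally show ?thesis
    by (simp add: lq_norm_def t_def)
qed

lemma orthonormal_basis_of_complement:
  fixes Q :: "'a::euclidean_space set"
  assumes "subspace Q"
  obtains B where "orthonormal B" "\<And>y b. y \<in> Q \<Longrightarrow> b \<in> B \<Longrightarrow> y \<bullet> b = 0" "card B + dim Q = DIM('a)"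
proof -
  define R where "R = {y. \<forall>x\<in>Q. orthogonal x y}"
  have "subspace R"
    unfolding R_def by (rule subspace_orthogonal_to_vectors)
  then obtain B where B: "B \<subseteq> R" "pairwise orthogonal B" "\<And>x. x \<in> B \<Longrightarrow> norm x = 1"
      "independent B" "card B = dim R"
    by (rule orthonormal_basis_subspace) blast
  have "dim {y \<in> UNIV. \<forall>x\<in>Q. orthogonal x y} + dim Q = dim (UNIV :: 'a set)"
    using assms by (intro dim_subspace_orthogonal_to_vectors) auto
  with B show ?thesis
    by (intro that[of B])
      (auto simp: orthonormal_def independent_imp_finite R_def orthogonal_def)
qed

section \<open>Trace duality for biorthogonal vectors\<close>

text \<open>Since \<open>E \<xi>\<^sub>i \<eta>\<^sub>j\<close> is the identity matrix, the expectation is the trace of the projection, which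
  is its rank.\<close>

lemma expectation_inner_proj_onto:
  assumes "biorthogonal M \<xi> \<eta>"
  shows "integrable M (\<lambda>\<omega>. \<xi> \<omega> \<bullet> proj_onto B (\<eta> \<omega>))"
    and "orthonormal B \<Longrightarrow> (\<integral>\<omega>. \<xi> \<omega> \<bullet> proj_onto B (\<eta> \<omega>) \<partial>M) = real (card B)"
proof -
  have eq: "\<xi> \<omega> \<bullet> proj_onto B (\<eta> \<omega>)
      = (\<Sum>b\<in>B. \<Sum>i\<in>UNIV. \<Sum>j\<in>UNIV. (\<xi> \<omega> $ i * \<eta> \<omega> $ j) * (b $ i * b $ j))" for \<omega>
    unfolding inner_proj_onto unfolding inner_vec_def sum_product by (simp add: mult_ac)
  have int: "integrable M (\<lambda>\<omega>. \<xi> \<omega> $ i * \<eta> \<omega> $ j)" for i j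
    using assms by (simp add: biorthogonal_def)
  show "integrable M (\<lambda>\<omega>. \<xi> \<omega> \<bullet> proj_onto B (\<eta> \<omega>))"
    unfolding eq by (intro Bochner_Integration.integrable_sum integrable_mult_left int)
  assume B: "orthonormal B"
  have E: "(\<integral>\<omega>. \<xi> \<omega> $ i * \<eta> \<omega> $ j \<partial>M) = (if i = j then 1 else 0)" for i j
    using assms by (simp add: biorthogonal_def)
  have "(\<integral>\<omega>. \<xi> \<omega> \<bullet> proj_onto B (\<eta> \<omega>) \<partial>M)
      = (\<Sum>b\<in>B. \<Sum>i\<in>UNIV. \<Sum>j\<in>UNIV. (\<integral>\<omega>. \<xi> \<omega> $ i * \<eta> \<omega> $ j \<partial>M) * (b $ i * b $ j))"
    unfolding eq by (simp add: Bochner_Integration.integral_sum int)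
  also have "\<dots> = (\<Sum>b\<in>B. b \<bullet> b)"
    by (simp add: E inner_vec_def if_distrib[of "\<lambda>c. c * _"] cong: if_cong)
  also have "\<dots> = real (card B)"
    using B by (simp add: orthonormal_def dot_square_norm)
  finally show "(\<integral>\<omega>. \<xi> \<omega> \<bullet> proj_onto B (\<eta> \<omega>) \<partial>M) = real (card B)" .
qed

text \<open>A projection is symmetric, so the \<open>k\<close>-th coordinate of the projected vector is the pairing of
  \<open>\<eta>\<close> with the \<open>k\<close>-th column, whose moment the weak moment bounds.\<close>

lemma lq_norm_proj_onto_moment:
  fixes \<eta> :: "'w \<Rightarrow> real ^ 'n"
  assumes \<eta>: "\<eta> \<in> borel_measurable M"
    and s: "weak_moment M p \<eta> = ennreal s" "0 \<le> s" and p: "1 < p"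
  shows "integrable M (\<lambda>\<omega>. lq_norm p (proj_onto B (\<eta> \<omega>)) powr p)"
    and "(\<integral>\<omega>. lq_norm p (proj_onto B (\<eta> \<omega>)) powr p \<partial>M) powr (1 / p)
           \<le> s * lq_norm p (\<chi> k. norm (proj_onto B (axis k 1)))"
proof -
  let ?c = "\<lambda>k. proj_onto B (axis k 1) :: real ^ 'n"
  have comp: "proj_onto B x $ k = x \<bullet> ?c k" for x k
    using inner_proj_onto_commute[of "axis k 1" B x] by (simp add: inner_axis')
  have eq: "lq_norm p (proj_onto B (\<eta> \<omega>)) powr p = (\<Sum>k\<in>UNIV. \<bar>\<eta> \<omega> \<bullet> ?c k\<bar> powr p)" for \<omega>
    using p by (simp add: lq_norm_powr comp)
  show "integrable M (\<lambda>\<omega>. lq_norm p (proj_onto B (\<eta> \<omega>)) powr p)"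
    unfolding eq by (intro Bochner_Integration.integrable_sum weak_moment_bound[OF \<eta> s p])
  have "(\<integral>\<omega>. lq_norm p (proj_onto B (\<eta> \<omega>)) powr p \<partial>M)
      = (\<Sum>k\<in>UNIV. \<integral>\<omega>. \<bar>\<eta> \<omega> \<bullet> ?c k\<bar> powr p \<partial>M)"
    unfolding eq by (intro Bochner_Integration.integral_sum weak_moment_bound[OF \<eta> s p])
  also have "\<dots> \<le> (\<Sum>k\<in>UNIV. (s * norm (?c k)) powr p)"
    by (intro sum_mono weak_moment_bound[OF \<eta> s p])
  also have "\<dots> = (s * lq_norm p (\<chi> k. norm (?c k))) powr p"
    using s p by (simp add: powr_mult lq_norm_nonneg lq_norm_powr sum_distrib_left)
  finally have "(\<integral>\<omega>. lq_norm p (proj_onto B (\<eta> \<omega>)) powr p \<partial>M) powr (1 / p)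
      \<le> ((s * lq_norm p (\<chi> k. norm (?c k))) powr p) powr (1 / p)"
    using p by (intro powr_mono2) (auto intro: integral_nonneg_AE)
  then show "(\<integral>\<omega>. lq_norm p (proj_onto B (\<eta> \<omega>)) powr p \<partial>M) powr (1 / p)
      \<le> s * lq_norm p (\<chi> k. norm (?c k))"
    using s p by (simp add: powr_powr lq_norm_nonneg)
qed

text \<open>The trace duality estimate for one subspace \<open>Q\<close>; in its application \<open>B\<close> is a basis of the whole
  orthogonal complement, so that \<open>card B\<close> is the codimension of \<open>Q\<close>.\<close>

lemma codimension_le_p_mean_dist_to:
  fixes \<xi> \<eta> :: "'w \<Rightarrow> real ^ 'n"
  assumes \<xi>[measurable]: "\<xi> \<in> borel_measurable M" and \<eta>[measurable]: "\<eta> \<in> borel_measurable M"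
    and bi: "biorthogonal M \<xi> \<eta>"
    and pq: "1 < q" "1 < q'" "1 / q + 1 / q' = 1"
    and s: "weak_moment M q' \<eta> = ennreal s" "0 \<le> s"
    and d: "p_mean M q (\<lambda>\<omega>. dist_to (lq_norm q) (\<xi> \<omega>) Q) = ennreal d" "0 \<le> d"
    and Q: "Q \<noteq> {}"
    and B: "orthonormal B" "\<And>y b. y \<in> Q \<Longrightarrow> b \<in> B \<Longrightarrow> y \<bullet> b = 0"
  shows "real (card B) \<le> d * s * lq_norm q' (\<chi> k. norm (proj_onto B (axis k 1)))"
proof -
  define \<rho> where "\<rho> \<omega> = dist_to (lq_norm q) (\<xi> \<omega>) Q" for \<omega>
  define g where "g \<omega> = lq_norm q' (proj_onto B (\<eta> \<omega>))" for \<omega>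
  have \<rho>m: "\<rho> \<in> borel_measurable M"
    unfolding \<rho>_def using measurable_compose[OF \<xi> borel_measurable_dist_to_lq_norm[of q Q]] pq Q by simp
  have gm: "g \<in> borel_measurable M"
    unfolding g_def lq_norm_def proj_onto_def by measurable
  have \<rho>0: "0 \<le> \<rho> \<omega>" for \<omega>
    unfolding \<rho>_def dist_to_def using Q by (intro cINF_greatest lq_norm_nonneg)
  have g0: "0 \<le> g \<omega>" for \<omega>
    by (simp add: g_def lq_norm_nonneg)
  have "p_mean M q \<rho> = ennreal d"
    using d(1) by (simp add: \<rho>_def[abs_def])
  then have \<rho>int: "integrable M (\<lambda>\<omega>. \<bar>\<rho> \<omega>\<bar> powr q)"
    and \<rho>d: "(\<integral>\<omega>. \<bar>\<rho> \<omega>\<bar> powr q \<partial>M) powr (1 / q) = d"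
    using p_mean_finite[OF \<rho>m, of q] d(2) by auto
  have gint: "integrable M (\<lambda>\<omega>. \<bar>g \<omega>\<bar> powr q')"
    using lq_norm_proj_onto_moment(1)[OF \<eta> s pq(2)] by (simp add: g_def lq_norm_nonneg)
  have "real (card B) = (\<integral>\<omega>. \<xi> \<omega> \<bullet> proj_onto B (\<eta> \<omega>) \<partial>M)"
    using expectation_inner_proj_onto(2)[OF bi B(1)] by simp
  also have "\<dots> \<le> (\<integral>\<omega>. \<bar>\<rho> \<omega> * g \<omega>\<bar> \<partial>M)"
  proof (rule integral_mono)
    show "integrable M (\<lambda>\<omega>. \<xi> \<omega> \<bullet> proj_onto B (\<eta> \<omega>))"
      by (rule expectation_inner_proj_onto[OF bi])
    show "integrable M (\<lambda>\<omega>. \<bar>\<rho> \<omega> * g \<omega>\<bar>)"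
      by (rule Holder_inequality_integral(1)[OF pq \<rho>m gm \<rho>int gint])
    fix \<omega>
    have "y \<bullet> proj_onto B (\<eta> \<omega>) = 0" if "y \<in> Q" for y
      using B(2)[OF that] by (simp add: inner_proj_onto)
    then have "\<bar>\<xi> \<omega> \<bullet> proj_onto B (\<eta> \<omega>)\<bar> \<le> \<rho> \<omega> * g \<omega>"
      unfolding \<rho>_def g_def by (rule inner_le_dist_to_lq_norm[OF pq Q])
    then show "\<xi> \<omega> \<bullet> proj_onto B (\<eta> \<omega>) \<le> \<bar>\<rho> \<omega> * g \<omega>\<bar>"
      by linarith
  qed
  also have "\<dots> \<le> d * (\<integral>\<omega>. \<bar>g \<omega>\<bar> powr q' \<partial>M) powr (1 / q')"
    using Holder_inequality_integral(2)[OF pq \<rho>m gm \<rho>int gint] by (simp add: \<rho>d)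
  also have "\<dots> \<le> d * (s * lq_norm q' (\<chi> k. norm (proj_onto B (axis k 1))))"
    using lq_norm_proj_onto_moment(2)[OF \<eta> s pq(2), of B] d(2)
    by (intro mult_left_mono) (auto simp: g_def lq_norm_nonneg)
  finally show ?thesis
    by (simp add: mult.assoc)
qed

text \<open>What remains of the problem is deterministic: any \<open>c \<ge> 0\<close> with
  \<open>c \<cdot> \<parallel>(|P e\<^sub>k|)\<^sub>k\<parallel>\<^bsub>q'\<^esub> \<le> rank P\<close> for all projections \<open>P\<close> of rank at least \<open>N - n\<close> gives a lower bound.\<close>

lemma avg_kolmogorov_width_ge:
  fixes \<xi> \<eta> :: "'w \<Rightarrow> real ^ 'n"
  assumes \<xi>: "\<xi> \<in> borel_measurable M" and \<eta>: "\<eta> \<in> borel_measurable M"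
    and bi: "biorthogonal M \<xi> \<eta>" and n: "n < CARD('n)"
    and pq: "1 < q" "1 < q'" "1 / q + 1 / q' = 1"
    and c: "\<And>B :: (real ^ 'n) set. orthonormal B \<Longrightarrow> real CARD('n) - real n \<le> real (card B) \<Longrightarrow>
       c * lq_norm q' (\<chi> k. norm (proj_onto B (axis k 1))) \<le> real (card B)"
    and c0: "0 \<le> c"
  shows "ennreal c / weak_moment M q' \<eta> \<le> avg_kolmogorov_width M \<xi> (lq_norm q) q n"
  unfolding avg_kolmogorov_width_def
proof (rule INF_greatest)
  fix Q :: "(real ^ 'n) set"
  assume "Q \<in> {Q. subspace Q \<and> dim Q \<le> n}"
  then have Q: "subspace Q" "dim Q \<le> n" by auto
  then have Qne: "Q \<noteq> {}" using subspace_0 by blast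
  obtain B where B: "orthonormal B" "\<And>y b. y \<in> Q \<Longrightarrow> b \<in> B \<Longrightarrow> y \<bullet> b = 0"
      "card B + dim Q = CARD('n)"
    using orthonormal_basis_of_complement[OF Q(1)] by (metis DIM_cart DIM_real mult_1_right)
  let ?L = "lq_norm q' (\<chi> k. norm (proj_onto B (axis k 1)))"
  let ?p = "p_mean M q (\<lambda>\<omega>. dist_to (lq_norm q) (\<xi> \<omega>) Q)"
  show "ennreal c / weak_moment M q' \<eta> \<le> ?p"
  proof (cases "weak_moment M q' \<eta>")
    case top
    then show ?thesis by simp
  next
    case s: (real s)
    show ?thesis
    proof (cases ?p)
      case top
      then show ?thesis by simp
    next
      case d: (real d)
      \<comment> \<open>Since the rank is positive, this also rules out \<open>s = 0\<close>, where \<open>c / s\<close> could be infinite.\<close>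
      have main: "real (card B) \<le> d * s * ?L"
        by (rule codimension_le_p_mean_dist_to[OF \<xi> \<eta> bi pq s(2,1) d(2,1) Qne B(1,2)])
      have pos: "0 < real (card B)"
        using B(3) Q(2) n by simp
      with main have "d * s * ?L \<noteq> 0" by linarith
      then have L: "0 < ?L" and s0: "0 < s"
        using lq_norm_nonneg[of q' "\<chi> k. norm (proj_onto B (axis k 1 :: real ^ 'n))"] s by auto
      have "c * ?L \<le> d * s * ?L"
        using c[OF B(1)] main B(3) Q(2) by fastforce
      then have "c / s \<le> d"
        using L s0 by (simp add: divide_le_eq)
      then show ?thesis
        using s0 s d c0 by (simp add: divide_ennreal)
    qed
  qed
qed

theorem theorem2:
  fixes M :: "'w measure"
    and \<xi> \<eta> :: "'w \<Rightarrow> real ^ 'n"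
    and q q' :: real
    and n :: nat
  assumes "prob_space M"
    and "\<xi> \<in> borel_measurable M"
    and "\<eta> \<in> borel_measurable M"
    and "biorthogonal M \<xi> \<eta>"
    and "n < CARD('n)"
    and "1 / q + 1 / q' = 1"
  shows "(1 < q \<and> q \<le> 2 \<longrightarrow>
           avg_kolmogorov_width M \<xi> (lq_norm q) q n
             \<ge> ennreal ((real CARD('n) - real n) powr (1 / q)) / weak_moment M q' \<eta>) \<and>
         (2 \<le> q \<longrightarrow>
           avg_kolmogorov_width M \<xi> (lq_norm q) q n
             \<ge> ennreal ((real CARD('n) - real n) powr (1 / 2) * real CARD('n) powr (1 / q - 1 / 2))
                 / weak_moment M q' \<eta>)"
proof -
  note width = avg_kolmogorov_width_ge[OF assms(2-5) _ _ assms(6)]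
  have n: "0 < real CARD('n) - real n" using assms(5) by simp
  have conj: "1 / q' = 1 - 1 / q" using assms(6) by simp
  have q': "1 < q'" if "1 < q"
  proof -
    have "0 < 1 / q'" "1 / q' < 1" using that conj by auto
    then show ?thesis by (simp add: divide_less_eq split: if_splits)
  qed
  have small: "ennreal ((real CARD('n) - real n) powr (1 / q)) / weak_moment M q' \<eta>
      \<le> avg_kolmogorov_width M \<xi> (lq_norm q) q n" if q: "1 < q" "q \<le> 2"
  proof (rule width)
    have "1 / q' \<le> 1 / 2" unfolding conj using q by (simp add: field_simps)
    then have "2 \<le> q'" using q' q by (simp add: field_simps)
    fix B :: "(real ^ 'n) set"
    assume B: "orthonormal B" "real CARD('n) - real n \<le> real (card B)"
    have "(real CARD('n) - real n) powr (1 / q) * lq_norm q' (\<chi> k. norm (proj_onto B (axis k 1)))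
        \<le> real (card B) powr (1 / q) * real (card B) powr (1 / q')"
      using lq_norm_proj_onto_axes_le_exponent_ge_2[OF B(1) \<open>2 \<le> q'\<close>] B(2) n q
      by (intro mult_mono powr_mono2) (auto simp: lq_norm_nonneg)
    also have "\<dots> = real (card B)"
      using assms(6) by (simp flip: powr_add)
    finally show "(real CARD('n) - real n) powr (1 / q)
        * lq_norm q' (\<chi> k. norm (proj_onto B (axis k 1))) \<le> real (card B)" .
  qed (use q q' in auto)
  have large: "ennreal ((real CARD('n) - real n) powr (1 / 2) * real CARD('n) powr (1 / q - 1 / 2))
      / weak_moment M q' \<eta> \<le> avg_kolmogorov_width M \<xi> (lq_norm q) q n" if q: "2 < q"
  proof (rule width)
    have "1 / 2 < 1 / q'" unfolding conj using q by (simp add: field_simps)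
    then have "q' < 2" using q' q by (simp add: field_simps)
    fix B :: "(real ^ 'n) set"
    assume B: "orthonormal B" "real CARD('n) - real n \<le> real (card B)"
    have "(real CARD('n) - real n) powr (1 / 2) * lq_norm q' (\<chi> k. norm (proj_onto B (axis k 1)))
        \<le> real (card B) powr (1 / 2)
            * (real (card B) powr (1 / 2) * real CARD('n) powr (1 / q' - 1 / 2))"
      using lq_norm_proj_onto_axes_le_exponent_less_2[OF B(1) _ \<open>q' < 2\<close>] q' B(2) n q
      by (intro mult_mono powr_mono2) (auto simp: lq_norm_nonneg)
    also have "\<dots> = real (card B) * real CARD('n) powr (1 / q' - 1 / 2)"
      by (simp flip: powr_add mult.assoc)
    finally have "real CARD('n) powr (1 / q - 1 / 2)
          * ((real CARD('n) - real n) powr (1 / 2) * lq_norm q' (\<chi> k. norm (proj_onto B (axis k 1))))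
        \<le> real CARD('n) powr (1 / q - 1 / 2) * (real (card B) * real CARD('n) powr (1 / q' - 1 / 2))"
      by (rule mult_left_mono) simp
    also have "\<dots> = real (card B) * real CARD('n) powr ((1 / q - 1 / 2) + (1 / q' - 1 / 2))"
      by (simp only: powr_add mult_ac)
    also have "(1 / q - 1 / 2) + (1 / q' - 1 / 2) = 0"
      using assms(6) by simp
    finally show "(real CARD('n) - real n) powr (1 / 2) * real CARD('n) powr (1 / q - 1 / 2)
        * lq_norm q' (\<chi> k. norm (proj_onto B (axis k 1))) \<le> real (card B)"
      by (simp add: mult_ac)
  qed (use q q' in auto)
  show ?thesis
    \<comment> \<open>At \<open>q = 2\<close> the power of \<open>N\<close> is 1 and the two bounds coincide.\<close>
    using small large by (cases "q = 2") auto
qed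

end
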